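(* Let $S_\lambda$ be a proper bounded weighted shift on a directed forest $\mathcal T=(V,p)$ and let $k\in\mathbb N$, $k\ge1$. Then the operator $S_\lambda^k$ is hyponormal if and only if the following two conditions are satisfied: (a) the forest $\mathcal T^k$ is leafless (i.e. $V=p^{[k]}(V)$); (b) for every $v\in V$, $$\mathtt h_k(v):=\sum_{u\in\mathrm{Chi}^{\langle k\rangle}(v)}\frac{|\lambda_u^{(k)}|^2}{\|S_\lambda^k e_u\|^2}\le 1.$$
   Context: A directed forest is a pair $\mathcal T=(V,p)$ where $V$ is a nonempty set and $p:V\to V$ is a function such that $p^n(v)=v$ with $n\ge 1$ implies $p(v)=v$. $\mathrm{root}(\mathcal T)=\{v\in V:p(v)=v\}$. For $k\ge1$, $\mathrm{Chi}^{\langle k\rangle}(v)=\{u\in V:p^k(u)=v\ne p^{k-1}(u)\}$. A forest is leafless if its parent function is surjective. The $k$-th power of $\mathcal T$ is the directed forest $\mathcal T^k=(V,p^{[k]})$, where $p^{[k]}(v)=p^k(v)$ if $p^{k-1}(v)\notin\mathrm{root}(\mathcal T)$ and $p^{[k]}(v)=v$ if $p^{k-1}(v)\in\mathrm{root}(\mathcal T)$. $\ell^2(V)$ is the complex Hilbert space of square-summable functions on $V$ with canonical orthonormal basis $\{e_v\}_{v\in V}$. A system of weights on $\mathcal T$ is $\lambda=\{\lambda_v\}_{v\in V}\subseteq\mathbb C$ with $\lambda_v=0$ for every root $v$. The weighted shift $S_\lambda$ on $\mathcal T$ is the operator in $\ell^2(V)$ given by $(S_\lambda f)(v)=\lambda_v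 f(p(v))$ (with maximal domain). It is proper if $\{v:\lambda_v=0\}=\mathrm{root}(\mathcal T)$. Put $\lambda^{(0)}_v=1$ and $\lambda^{(k)}_v=\lambda^{(k-1)}_{p(v)}\lambda_v$ for $k\ge1$. A bounded operator $T$ is hyponormal if $T^*T-TT^*\ge0$. Empty sums are $0$. (Condition (a) together with properness prevents the denominators in (b) from being zero.) *)

theory Defs
  imports "HOL-Analysis.Analysis"
begin

section \<open>Directed forests\<close>

definition directed_forest :: "'v set \<Rightarrow> ('v \<Rightarrow> 'v) \<Rightarrow> bool" where
  "directed_forest V p \<longleftrightarrow> V \<noteq> {} \<and> p \<in> V \<rightarrow> V \<and>
     (\<forall>v\<in>V. \<forall>n\<ge>1. (p ^^ n) v = v \<longrightarrow> p v = v)"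

definition forest_roots :: "'v set \<Rightarrow> ('v \<Rightarrow> 'v) \<Rightarrow> 'v set" where
  "forest_roots V p = {v \<in> V. p v = v}"

text \<open>The \<open>k\<close>-th children of \<open>v\<close>, for \<open>k \<ge> 1\<close>.\<close>

definition forest_chi :: "'v set \<Rightarrow> ('v \<Rightarrow> 'v) \<Rightarrow> nat \<Rightarrow> 'v \<Rightarrow> 'v set" where
  "forest_chi V p k v = {u \<in> V. (p ^^ k) u = v \<and> v \<noteq> (p ^^ (k - 1)) u}"

definition leafless :: "'v set \<Rightarrow> ('v \<Rightarrow> 'v) \<Rightarrow> bool" where
  "leafless V p \<longleftrightarrow> p ` V = V"

text \<open>The parent function of the \<open>k\<close>-th power of the forest \<open>(V, p)\<close>, for \<open>k \<ge> 1\<close>.\<close>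

definition power_parent :: "'v set \<Rightarrow> ('v \<Rightarrow> 'v) \<Rightarrow> nat \<Rightarrow> 'v \<Rightarrow> 'v" where
  "power_parent V p k v = (if (p ^^ (k - 1)) v \<in> forest_roots V p then v else (p ^^ k) v)"


section \<open>The Hilbert space of square-summable functions and its bounded operators\<close>

text \<open>
  Elements are total functions that vanish off \<open>V\<close>; operators are functions on
  \<open>'v \<Rightarrow> complex\<close> of which only the restriction to \<open>ell2 V\<close> matters.
\<close>

definition ell2 :: "'v set \<Rightarrow> ('v \<Rightarrow> complex) set" where
  "ell2 V = {f. (\<forall>v. v \<notin> V \<longrightarrow> f v = 0) \<and> (\<lambda>v. (cmod (f v))\<^sup>2) summable_on V}"

definition ell2_inner :: "'v set \<Rightarrow> ('v \<Rightarrow> complex) \<Rightarrow> ('v \<Rightarrow> complex) \<Rightarrow> complex" where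
  "ell2_inner V f g = (\<Sum>\<^sub>\<infinity>v\<in>V. f v * cnj (g v))"

definition ell2_norm :: "'v set \<Rightarrow> ('v \<Rightarrow> complex) \<Rightarrow> real" where
  "ell2_norm V f = sqrt (\<Sum>\<^sub>\<infinity>v\<in>V. (cmod (f v))\<^sup>2)"

definition ell2_basis :: "'v \<Rightarrow> 'v \<Rightarrow> complex" where
  "ell2_basis u = (\<lambda>v. if v = u then 1 else 0)"

definition ell2_bounded_operator ::
  "'v set \<Rightarrow> (('v \<Rightarrow> complex) \<Rightarrow> ('v \<Rightarrow> complex)) \<Rightarrow> bool" where
  "ell2_bounded_operator V T \<longleftrightarrow>
     T \<in> ell2 V \<rightarrow> ell2 V \<and>
     (\<forall>f\<in>ell2 V. \<forall>g\<in>ell2 V. T (\<lambda>v. f v + g v) = (\<lambda>v. T f v + T g v)) \<and>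
     (\<forall>c. \<forall>f\<in>ell2 V. T (\<lambda>v. c * f v) = (\<lambda>v. c * T f v)) \<and>
     (\<exists>C. \<forall>f\<in>ell2 V. ell2_norm V (T f) \<le> C * ell2_norm V f)"

text \<open>
  For a bounded \<open>T\<close> and \<open>g \<in> ell2 V\<close>, the described vector exists (Riesz) and is unique.
\<close>

definition ell2_adjoint ::
  "'v set \<Rightarrow> (('v \<Rightarrow> complex) \<Rightarrow> ('v \<Rightarrow> complex)) \<Rightarrow> (('v \<Rightarrow> complex) \<Rightarrow> ('v \<Rightarrow> complex))" where
  "ell2_adjoint V T g =
     (THE h. h \<in> ell2 V \<and> (\<forall>f\<in>ell2 V. ell2_inner V (T f) g = ell2_inner V f h))"

definition ell2_positive ::
  "'v set \<Rightarrow> (('v \<Rightarrow> complex) \<Rightarrow> ('v \<Rightarrow> complex)) \<Rightarrow> bool" where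
  "ell2_positive V A \<longleftrightarrow> (\<forall>f\<in>ell2 V. ell2_inner V (A f) f \<in> \<real>\<^sub>\<ge>\<^sub>0)"

definition ell2_hyponormal ::
  "'v set \<Rightarrow> (('v \<Rightarrow> complex) \<Rightarrow> ('v \<Rightarrow> complex)) \<Rightarrow> bool" where
  "ell2_hyponormal V T \<longleftrightarrow>
     ell2_bounded_operator V T \<and>
     ell2_positive V (\<lambda>f v. ell2_adjoint V T (T f) v - T (ell2_adjoint V T f) v)"


section \<open>Weighted shifts\<close>

definition weight_system :: "'v set \<Rightarrow> ('v \<Rightarrow> 'v) \<Rightarrow> ('v \<Rightarrow> complex) \<Rightarrow> bool" where
  "weight_system V p lam \<longleftrightarrow> (\<forall>v\<in>forest_roots V p. lam v = 0)"

text \<open>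
  As an operator in \<open>ell2 V\<close>, the weighted shift has the maximal domain
  \<open>{f \<in> ell2 V. weighted_shift V p lam f \<in> ell2 V}\<close>.  Hence
  \<open>ell2_bounded_operator V (weighted_shift V p lam)\<close> says that this domain is all of
  \<open>ell2 V\<close> and that the operator is bounded (linearity being automatic).
\<close>

definition weighted_shift ::
  "'v set \<Rightarrow> ('v \<Rightarrow> 'v) \<Rightarrow> ('v \<Rightarrow> complex) \<Rightarrow> ('v \<Rightarrow> complex) \<Rightarrow> ('v \<Rightarrow> complex)" where
  "weighted_shift V p lam f = (\<lambda>v. if v \<in> V then lam v * f (p v) else 0)"

definition proper_weights :: "'v set \<Rightarrow> ('v \<Rightarrow> 'v) \<Rightarrow> ('v \<Rightarrow> complex) \<Rightarrow> bool" where
  "proper_weights V p lam \<longleftrightarrow> {v \<in> V. lam v = 0} = forest_roots V p"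

primrec iterated_weight :: "('v \<Rightarrow> 'v) \<Rightarrow> ('v \<Rightarrow> complex) \<Rightarrow> nat \<Rightarrow> 'v \<Rightarrow> complex" where
  "iterated_weight p lam 0 v = 1"
| "iterated_weight p lam (Suc k) v = iterated_weight p lam k (p v) * lam v"

text \<open>
  The sum may be infinite and may diverge, so it is taken in \<^typ>\<open>ennreal\<close>, where every
  family is summable.  If a denominator vanishes while the numerator does not, the
  quotient is \<open>\<infinity>\<close>; this cannot happen when the \<open>k\<close>-th power of the forest is leafless
  and the weights are proper.
\<close>

definition h_fun :: "'v set \<Rightarrow> ('v \<Rightarrow> 'v) \<Rightarrow> ('v \<Rightarrow> complex) \<Rightarrow> nat \<Rightarrow> 'v \<Rightarrow> ennreal" where
  "h_fun V p lam k v =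
     (\<Sum>\<^sub>\<infinity>u\<in>forest_chi V p k v.
        ennreal ((cmod (iterated_weight p lam k u))\<^sup>2) /
        ennreal ((ell2_norm V ((weighted_shift V p lam ^^ k) (ell2_basis u)))\<^sup>2))"

end

theory Submission
  imports Defs
begin

text \<open>
  The power \<open>S\<^sub>\<lambda>\<^sup>k\<close> is itself a weighted shift \<open>(T f)(u) = w\<^sub>u f(q u)\<close>, with \<open>q = p\<^sup>k\<close> and
  \<open>w = \<lambda>\<^sup>(\<^sup>k\<^sup>)\<close>.  For such a \<open>T\<close>, put \<open>N\<^sub>u = \<parallel>T e\<^sub>u\<parallel>\<^sup>2\<close>.  Then \<open>\<parallel>T f\<parallel>\<^sup>2 = \<Sum>\<^sub>u N\<^sub>u |f(u)|\<^sup>2\<close>, while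
  \<open>(T\<^sup>* f)(v)\<close> is the sum of \<open>cnj w\<^sub>u f(u)\<close> over the fibre of \<open>q\<close> over \<open>v\<close>.  The fibres are disjoint,
  so \<open>\<parallel>T\<^sup>* f\<parallel> \<le> \<parallel>T f\<parallel>\<close> can be tested on each of them separately; there it holds for all \<open>f\<close> iff
  \<open>\<Sum> |w\<^sub>u|\<^sup>2 / N\<^sub>u \<le> 1\<close>, by the Cauchy-Schwarz inequality and its equality case
  \<open>f(u) = w\<^sub>u / N\<^sub>u\<close>.  Leaflessness of the power of the forest says that \<open>N\<^sub>u > 0\<close> whenever
  \<open>w\<^sub>u \<noteq> 0\<close>.  With division in \<open>ennreal\<close> it is implied by the bound, since a vanishing
  denominator makes the sum infinite.
\<close>

section \<open>Inequalities for infinite sums\<close>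

text \<open>The finite Cauchy-Schwarz inequality bounds every partial sum of the absolute products
  by the same constant, and this bound passes to the limit.\<close>

lemma infsum_Cauchy_Schwarz:
  fixes a b :: "'a \<Rightarrow> complex"
  assumes a: "(\<lambda>i. (cmod (a i))\<^sup>2) summable_on A" and b: "(\<lambda>i. (cmod (b i))\<^sup>2) summable_on A"
  shows "(\<lambda>i. a i * b i) summable_on A"
    and "(cmod (\<Sum>\<^sub>\<infinity>i\<in>A. a i * b i))\<^sup>2
           \<le> (\<Sum>\<^sub>\<infinity>i\<in>A. (cmod (a i))\<^sup>2) * (\<Sum>\<^sub>\<infinity>i\<in>A. (cmod (b i))\<^sup>2)"
proof -
  have abs: "(\<lambda>i. cmod (a i * b i)) summable_on A"
    by (rule abs_summable_product) (use a b in \<open>simp_all add: norm_mult power2_eq_square\<close>)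
  then show "(\<lambda>i. a i * b i) summable_on A"
    by (rule abs_summable_summable)
  let ?K = "(\<Sum>\<^sub>\<infinity>i\<in>A. (cmod (a i))\<^sup>2) * (\<Sum>\<^sub>\<infinity>i\<in>A. (cmod (b i))\<^sup>2)"
  have "(\<Sum>\<^sub>\<infinity>i\<in>A. cmod (a i * b i)) \<le> sqrt ?K"
  proof (rule infsum_le_finite_sums[OF abs])
    fix F assume F: "finite F" "F \<subseteq> A"
    have "(\<Sum>i\<in>F. cmod (a i) * cmod (b i))\<^sup>2
            \<le> (\<Sum>i\<in>F. (cmod (a i))\<^sup>2) * (\<Sum>i\<in>F. (cmod (b i))\<^sup>2)"
      by (rule Cauchy_Schwarz_ineq_sum)
    also have "\<dots> \<le> ?K"
    proof (rule mult_mono)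
      show "(\<Sum>i\<in>F. (cmod (a i))\<^sup>2) \<le> (\<Sum>\<^sub>\<infinity>i\<in>A. (cmod (a i))\<^sup>2)"
        by (rule finite_sum_le_infsum[OF a F]) simp
      show "(\<Sum>i\<in>F. (cmod (b i))\<^sup>2) \<le> (\<Sum>\<^sub>\<infinity>i\<in>A. (cmod (b i))\<^sup>2)"
        by (rule finite_sum_le_infsum[OF b F]) simp
    qed (simp_all add: sum_nonneg infsum_nonneg)
    finally show "(\<Sum>i\<in>F. cmod (a i * b i)) \<le> sqrt ?K"
      by (simp add: norm_mult real_le_rsqrt)
  qed
  then have "cmod (\<Sum>\<^sub>\<infinity>i\<in>A. a i * b i) \<le> sqrt ?K"
    using norm_infsum_bound[OF abs] by linarith
  then have "(cmod (\<Sum>\<^sub>\<infinity>i\<in>A. a i * b i))\<^sup>2 \<le> (sqrt ?K)\<^sup>2"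
    by (intro power_mono) auto
  then show "(cmod (\<Sum>\<^sub>\<infinity>i\<in>A. a i * b i))\<^sup>2 \<le> ?K"
    by (simp add: infsum_nonneg)
qed

text \<open>In \<open>ennreal\<close> an infinite sum is the supremum of its finite partial sums.
  This reduces the bound on \<open>h_fun\<close> to finite sets, with no summability to
  check.\<close>

lemma infsum_ennreal_le_iff:
  fixes c :: ennreal
  shows "(\<Sum>\<^sub>\<infinity>x\<in>A. f x) \<le> c \<longleftrightarrow> (\<forall>F. finite F \<and> F \<subseteq> A \<longrightarrow> sum f F \<le> c)"
  by (simp add: nonneg_infsum_complete SUP_le_iff)

section \<open>Inner product, adjoint and hyponormality on the sequence space\<close>

lemma ell2_summable: "f \<in> ell2 V \<Longrightarrow> (\<lambda>v. (cmod (f v))\<^sup>2) summable_on V"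
  by (simp add: ell2_def)

lemma ell2_summable_mult_cnj:
  assumes "f \<in> ell2 V" "g \<in> ell2 V"
  shows "(\<lambda>v. f v * cnj (g v)) summable_on V"
  using assms by (intro infsum_Cauchy_Schwarz) (auto simp: ell2_summable)

lemma ell2_norm_nonneg: "0 \<le> ell2_norm V f"
  by (simp add: ell2_norm_def infsum_nonneg)

lemma ell2_norm_power2: "(ell2_norm V f)\<^sup>2 = (\<Sum>\<^sub>\<infinity>v\<in>V. (cmod (f v))\<^sup>2)"
  by (simp add: ell2_norm_def infsum_nonneg)

lemma ell2_inner_self:
  assumes "f \<in> ell2 V"
  shows "ell2_inner V f f = of_real ((ell2_norm V f)\<^sup>2)"
proof -
  have "((\<lambda>v. complex_of_real ((cmod (f v))\<^sup>2)) has_sum of_real ((ell2_norm V f)\<^sup>2)) V"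
    unfolding has_sum_of_real_iff ell2_norm_power2
    by (rule has_sum_infsum[OF ell2_summable[OF assms]])
  then show ?thesis
    unfolding ell2_inner_def by (intro infsumI) (simp only: complex_norm_square)
qed

lemma ell2_inner_commute: "ell2_inner V g f = cnj (ell2_inner V f g)"
  by (simp add: ell2_inner_def mult.commute flip: infsum_cnj)

lemma ell2_inner_diff_left:
  assumes "f \<in> ell2 V" "g \<in> ell2 V" "h \<in> ell2 V"
  shows "ell2_inner V (\<lambda>v. f v - g v) h = ell2_inner V f h - ell2_inner V g h"
proof -
  have "(\<lambda>v. f v * cnj (h v)) summable_on V" "(\<lambda>v. - (g v * cnj (h v))) summable_on V"
    using assms by (simp_all add: ell2_summable_mult_cnj summable_on_uminus)
  from infsum_add[OF this] show ?thesis
    by (simp add: ell2_inner_def left_diff_distrib infsum_uminus)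
qed

lemma ell2_finite_support:
  assumes "finite F" "F \<subseteq> V" "\<And>v. v \<notin> F \<Longrightarrow> f v = 0"
  shows "f \<in> ell2 V"
proof -
  have "(\<lambda>v. (cmod (f v))\<^sup>2) summable_on V \<longleftrightarrow> (\<lambda>v. (cmod (f v))\<^sup>2) summable_on F"
    using assms by (intro summable_on_cong_neutral) auto
  then show ?thesis
    using assms by (auto simp: ell2_def)
qed

lemma ell2_basis_mem: "u \<in> V \<Longrightarrow> ell2_basis u \<in> ell2 V"
  by (rule ell2_finite_support[of "{u}"]) (auto simp: ell2_basis_def)

lemma ell2_inner_basis_left:
  assumes "u \<in> V"
  shows "ell2_inner V (ell2_basis u) h = cnj (h u)"
proof -
  have "ell2_inner V (ell2_basis u) h = (\<Sum>\<^sub>\<infinity>v\<in>{u}. cnj (h v))"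
    unfolding ell2_inner_def using assms
    by (intro infsum_cong_neutral) (auto simp: ell2_basis_def)
  then show ?thesis by simp
qed

lemma ell2_norm_basis:
  assumes "u \<in> V"
  shows "ell2_norm V (ell2_basis u) = 1"
proof -
  have "(\<Sum>\<^sub>\<infinity>v\<in>V. (cmod (ell2_basis u v))\<^sup>2) = (\<Sum>\<^sub>\<infinity>v\<in>{u}. 1)"
    using assms by (intro infsum_cong_neutral) (auto simp: ell2_basis_def)
  then show ?thesis
    by (simp add: ell2_norm_def)
qed

text \<open>Testing against basis vectors determines \<open>h\<close> on \<open>V\<close>, and
  members of \<open>ell2 V\<close> vanish elsewhere. So a vector that satisfies the adjoint equation
  is the only one, and the definite description returns it.\<close>

lemma ell2_adjoint_eqI:
  assumes h: "h \<in> ell2 V" and adj: "\<And>f. f \<in> ell2 V \<Longrightarrow> ell2_inner V (T f) g = ell2_inner V f h"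
  shows "ell2_adjoint V T g = h"
  unfolding ell2_adjoint_def
proof (rule the_equality)
  fix h' assume h': "h' \<in> ell2 V \<and> (\<forall>f\<in>ell2 V. ell2_inner V (T f) g = ell2_inner V f h')"
  show "h' = h"
  proof
    fix u
    show "h' u = h u"
    proof (cases "u \<in> V")
      case True
      then have "ell2_inner V (ell2_basis u) h' = ell2_inner V (ell2_basis u) h"
        using adj h' ell2_basis_mem by metis
      then show ?thesis
        using True by (simp add: ell2_inner_basis_left)
    qed (use h h' in \<open>auto simp: ell2_def\<close>)
  qed
qed (use assms in auto)

text \<open>By uniqueness the adjoint agrees with \<open>A\<close> on \<open>ell2 V\<close>, and the
  quadratic form of the self-commutator at \<open>f\<close> is the real number
  \<open>(ell2_norm V (T f))^2 - (ell2_norm V (A f))^2\<close>.\<close>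

lemma ell2_hyponormal_iff_norm_le:
  assumes bdd: "ell2_bounded_operator V T"
    and A: "\<And>g. g \<in> ell2 V \<Longrightarrow> A g \<in> ell2 V"
    and adj: "\<And>f g. f \<in> ell2 V \<Longrightarrow> g \<in> ell2 V \<Longrightarrow> ell2_inner V (T f) g = ell2_inner V f (A g)"
  shows "ell2_hyponormal V T \<longleftrightarrow> (\<forall>f\<in>ell2 V. ell2_norm V (A f) \<le> ell2_norm V (T f))"
proof -
  have T: "T f \<in> ell2 V" if "f \<in> ell2 V" for f
    using bdd that by (auto simp: ell2_bounded_operator_def)
  have adjoint: "ell2_adjoint V T g = A g" if "g \<in> ell2 V" for g
    using that by (intro ell2_adjoint_eqI A adj)
  have "ell2_inner V (\<lambda>v. ell2_adjoint V T (T f) v - T (ell2_adjoint V T f) v) f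
          = of_real ((ell2_norm V (T f))\<^sup>2 - (ell2_norm V (A f))\<^sup>2)" if f: "f \<in> ell2 V" for f
  proof -
    have "ell2_inner V (A (T f)) f = cnj (ell2_inner V (T f) (T f))"
      unfolding adj[OF f T[OF f]] by (rule ell2_inner_commute)
    also have "\<dots> = of_real ((ell2_norm V (T f))\<^sup>2)"
      unfolding ell2_inner_self[OF T[OF f]] by (rule complex_cnj_complex_of_real)
    finally have 1: "ell2_inner V (A (T f)) f = of_real ((ell2_norm V (T f))\<^sup>2)" .
    have 2: "ell2_inner V (T (A f)) f = of_real ((ell2_norm V (A f))\<^sup>2)"
      unfolding adj[OF A[OF f] f] by (rule ell2_inner_self[OF A[OF f]])
    show ?thesis
      unfolding adjoint[OF f] adjoint[OF T[OF f]]
        ell2_inner_diff_left[OF A[OF T[OF f]] T[OF A[OF f]] f] 1 2 by (rule of_real_diff[symmetric])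
  qed
  then show ?thesis
    unfolding ell2_hyponormal_def ell2_positive_def
    by (simp add: bdd nonneg_Reals_of_real_iff power_mono_iff ell2_norm_nonneg
        del: of_real_diff of_real_power)
qed

section \<open>Summation over the fibres of a self-map\<close>

lemma infsum_fibres:
  fixes f :: "'a \<Rightarrow> 'b::{banach}"
  assumes q: "q \<in> V \<rightarrow> V" and f: "f summable_on V"
  shows "(\<lambda>v. \<Sum>\<^sub>\<infinity>u\<in>{u\<in>V. q u = v}. f u) summable_on V"
    and "(\<Sum>\<^sub>\<infinity>v\<in>V. \<Sum>\<^sub>\<infinity>u\<in>{u\<in>V. q u = v}. f u) = (\<Sum>\<^sub>\<infinity>u\<in>V. f u)"
proof -
  let ?S = "Sigma V (\<lambda>v. {u\<in>V. q u = v})"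
  \<comment> \<open>The first component of a pair in \<open>?S\<close> is \<open>q\<close> of the
    second, whence injectivity; surjectivity holds because \<open>q\<close> maps into
    \<open>V\<close>.\<close>
  have bij: "bij_betw snd ?S V"
    using q by (force simp: bij_betw_def inj_on_def)
  have "(\<lambda>x. f (snd x)) summable_on ?S"
    using f by (simp add: summable_on_reindex_bij_betw[OF bij])
  then have S: "(\<lambda>(v, u). f u) summable_on ?S"
    by (simp add: case_prod_beta')
  show "(\<lambda>v. \<Sum>\<^sub>\<infinity>u\<in>{u\<in>V. q u = v}. f u) summable_on V"
    using summable_on_Sigma_banach[OF S] .
  have "(\<Sum>\<^sub>\<infinity>v\<in>V. \<Sum>\<^sub>\<infinity>u\<in>{u\<in>V. q u = v}. f u) = (\<Sum>\<^sub>\<infinity>x\<in>?S. f (snd x))"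
    using infsum_Sigma'_banach[OF S] by (simp add: case_prod_beta')
  then show "(\<Sum>\<^sub>\<infinity>v\<in>V. \<Sum>\<^sub>\<infinity>u\<in>{u\<in>V. q u = v}. f u) = (\<Sum>\<^sub>\<infinity>u\<in>V. f u)"
    by (simp add: infsum_reindex_bij_betw[OF bij])
qed

section \<open>Bounded weighted shifts along an arbitrary self-map\<close>

text \<open>The map \<open>q\<close> is to be instantiated with \<open>p ^^ k\<close>. A root then
  lies in its own fibre, which is harmless because its weight vanishes.\<close>

locale bounded_weighted_shift =
  fixes V :: "'v set" and q :: "'v \<Rightarrow> 'v" and w :: "'v \<Rightarrow> complex"
  assumes q: "q \<in> V \<rightarrow> V" and bounded: "ell2_bounded_operator V (weighted_shift V q w)"
begin

abbreviation "shift \<equiv> weighted_shift V q w"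

abbreviation "fibre v \<equiv> {u \<in> V. q u = v}"

text \<open>This is the number N of the overview: for \<open>v \<in> V\<close> it is the squared
  norm of \<open>shift (ell2_basis v)\<close>.\<close>

definition fibre_weight :: "'v \<Rightarrow> real" where
  "fibre_weight v = (\<Sum>\<^sub>\<infinity>u\<in>fibre v. (cmod (w u))\<^sup>2)"

text \<open>Explicit candidate for the adjoint of \<open>shift\<close>; \<open>coshift_mem\<close>
  and \<open>inner_shift_left\<close> confirm it.\<close>

definition coshift :: "('v \<Rightarrow> complex) \<Rightarrow> ('v \<Rightarrow> complex)" where
  "coshift g = (\<lambda>v. if v \<in> V then \<Sum>\<^sub>\<infinity>u\<in>fibre v. cnj (w u) * g u else 0)"

lemma coshift_eq: "v \<in> V \<Longrightarrow> coshift g v = (\<Sum>\<^sub>\<infinity>u\<in>fibre v. cnj (w u) * g u)"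
  by (simp add: coshift_def)

lemma shift_mem: "f \<in> ell2 V \<Longrightarrow> shift f \<in> ell2 V"
  using bounded by (auto simp: ell2_bounded_operator_def)

lemma shift_basis:
  assumes "v \<in> V"
  shows fibre_weight_summable: "(\<lambda>u. (cmod (w u))\<^sup>2) summable_on fibre v"
    and norm_shift_basis: "(ell2_norm V (shift (ell2_basis v)))\<^sup>2 = fibre_weight v"
proof -
  have "(\<lambda>u. (cmod (shift (ell2_basis v) u))\<^sup>2) summable_on V
          \<longleftrightarrow> (\<lambda>u. (cmod (w u))\<^sup>2) summable_on fibre v"
    by (intro summable_on_cong_neutral) (auto simp: weighted_shift_def ell2_basis_def)
  then show "(\<lambda>u. (cmod (w u))\<^sup>2) summable_on fibre v"
    using assms by (simp add: ell2_summable shift_mem ell2_basis_mem)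
  show "(ell2_norm V (shift (ell2_basis v)))\<^sup>2 = fibre_weight v"
    unfolding ell2_norm_power2 fibre_weight_def
    by (intro infsum_cong_neutral) (auto simp: weighted_shift_def ell2_basis_def)
qed

lemma fibre_weight_nonneg: "0 \<le> fibre_weight v"
  by (simp add: fibre_weight_def infsum_nonneg)

text \<open>Basis vectors have norm 1, so the square of any bound for the operator serves as
  \<open>K\<close>.\<close>

lemma fibre_weight_bounded:
  obtains K where "\<And>v. v \<in> V \<Longrightarrow> fibre_weight v \<le> K"
proof -
  obtain C where C: "\<And>f. f \<in> ell2 V \<Longrightarrow> ell2_norm V (shift f) \<le> C * ell2_norm V f"
    using bounded unfolding ell2_bounded_operator_def by blast
  have "fibre_weight v \<le> C\<^sup>2" if v: "v \<in> V" for v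
  proof -
    have "ell2_norm V (shift (ell2_basis v)) \<le> C"
      using C[OF ell2_basis_mem[OF v]] by (simp add: ell2_norm_basis v)
    then show ?thesis
      unfolding norm_shift_basis[OF v, symmetric] by (intro power_mono ell2_norm_nonneg)
  qed
  then show thesis by (rule that)
qed

text \<open>Cauchy-Schwarz on each fibre bounds the squared value by \<open>K\<close> times the mass
  of \<open>g\<close> on that fibre, and these masses are summable over \<open>V\<close>.\<close>

lemma coshift_mem:
  assumes g: "g \<in> ell2 V"
  shows "coshift g \<in> ell2 V"
proof -
  obtain K where K: "\<And>v. v \<in> V \<Longrightarrow> fibre_weight v \<le> K"
    using fibre_weight_bounded by blast
  let ?G = "\<lambda>v. \<Sum>\<^sub>\<infinity>u\<in>fibre v. (cmod (g u))\<^sup>2"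
  have "(\<lambda>v. K * ?G v) summable_on V"
    by (intro summable_on_cmult_right infsum_fibres q ell2_summable g)
  moreover have "(cmod (coshift g v))\<^sup>2 \<le> K * ?G v" if v: "v \<in> V" for v
  proof -
    have "(\<lambda>u. (cmod (g u))\<^sup>2) summable_on fibre v"
      by (rule summable_on_subset_banach[OF ell2_summable[OF g]]) auto
    then have "(cmod (\<Sum>\<^sub>\<infinity>u\<in>fibre v. cnj (w u) * g u))\<^sup>2 \<le> fibre_weight v * ?G v"
      using infsum_Cauchy_Schwarz(2)[of "\<lambda>u. cnj (w u)" "fibre v" g] fibre_weight_summable[OF v]
      by (simp add: fibre_weight_def)
    also have "\<dots> \<le> K * ?G v"
      by (intro mult_right_mono K v infsum_nonneg) auto
    finally show ?thesis
      using v by (simp add: coshift_def)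
  qed
  ultimately have "(\<lambda>v. (cmod (coshift g v))\<^sup>2) summable_on V"
    by (rule summable_on_comparison_test) auto
  then show ?thesis
    by (simp add: ell2_def coshift_def)
qed

text \<open>Group the inner product by fibres: on \<open>fibre v\<close> the factor
  \<open>f (q u)\<close> is the constant \<open>f v\<close> and can be pulled out.\<close>

lemma inner_shift_left:
  assumes f: "f \<in> ell2 V" and g: "g \<in> ell2 V"
  shows "ell2_inner V (shift f) g = ell2_inner V f (coshift g)"
proof -
  have "ell2_inner V (shift f) g = (\<Sum>\<^sub>\<infinity>v\<in>V. \<Sum>\<^sub>\<infinity>u\<in>fibre v. shift f u * cnj (g u))"
    unfolding ell2_inner_def
    by (rule infsum_fibres(2)[OF q ell2_summable_mult_cnj[OF shift_mem[OF f] g], symmetric])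
  also have "\<dots> = (\<Sum>\<^sub>\<infinity>v\<in>V. \<Sum>\<^sub>\<infinity>u\<in>fibre v. f v * cnj (cnj (w u) * g u))"
    by (intro infsum_cong) (auto simp: weighted_shift_def)
  also have "\<dots> = (\<Sum>\<^sub>\<infinity>v\<in>V. f v * cnj (coshift g v))"
    unfolding infsum_cmult_right' infsum_cnj by (intro infsum_cong) (simp add: coshift_def)
  finally show ?thesis
    by (simp add: ell2_inner_def)
qed

section \<open>Hyponormality tested on fibres\<close>

lemma hyponormal_iff_norm_coshift_le:
  "ell2_hyponormal V shift
     \<longleftrightarrow> (\<forall>f\<in>ell2 V. (ell2_norm V (coshift f))\<^sup>2 \<le> (ell2_norm V (shift f))\<^sup>2)"
  using ell2_hyponormal_iff_norm_le[OF bounded coshift_mem inner_shift_left]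
  by (simp add: power_mono_iff ell2_norm_nonneg)

text \<open>Equivalently, \<open>shift\<^sup>* shift\<close> is the diagonal operator with entries \<open>fibre_weight v\<close>.\<close>

lemma norm_shift:
  assumes f: "f \<in> ell2 V"
  shows norm_shift_summable: "(\<lambda>v. fibre_weight v * (cmod (f v))\<^sup>2) summable_on V"
    and norm_shift_power2:
      "(ell2_norm V (shift f))\<^sup>2 = (\<Sum>\<^sub>\<infinity>v\<in>V. fibre_weight v * (cmod (f v))\<^sup>2)"
proof -
  have *: "(\<Sum>\<^sub>\<infinity>u\<in>fibre v. (cmod (shift f u))\<^sup>2) = fibre_weight v * (cmod (f v))\<^sup>2" for v
    unfolding fibre_weight_def infsum_cmult_left'[symmetric]
    by (intro infsum_cong) (auto simp: weighted_shift_def norm_mult power_mult_distrib)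
  note fib = infsum_fibres[OF q ell2_summable[OF shift_mem[OF f]], unfolded *]
  show "(\<lambda>v. fibre_weight v * (cmod (f v))\<^sup>2) summable_on V"
    by (rule fib)
  show "(ell2_norm V (shift f))\<^sup>2 = (\<Sum>\<^sub>\<infinity>v\<in>V. fibre_weight v * (cmod (f v))\<^sup>2)"
    unfolding ell2_norm_power2 by (rule fib(2)[symmetric])
qed

text \<open>For the test vector \<open>f\<close> below, both the value of \<open>coshift f\<close>
  at \<open>v\<close> and the squared norm of \<open>shift f\<close> equal the sum
  \<open>?s\<close>, so hyponormality gives \<open>?s^2 \<le> ?s\<close>.\<close>

lemma hyponormal_imp_finite_sum_le:
  assumes hyp: "ell2_hyponormal V shift" and v: "v \<in> V" and F: "finite F" "F \<subseteq> fibre v"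
  shows "(\<Sum>u\<in>F. (cmod (w u))\<^sup>2 / fibre_weight u) \<le> 1"
proof -
  \<comment> \<open>The equality case of Cauchy-Schwarz, cut off to the finite set \<open>F\<close>
    so that it lies in \<open>ell2 V\<close>. Where \<open>fibre_weight u = 0\<close>, division by
    zero makes both \<open>f u\<close> and the term of \<open>?s\<close> zero.\<close>
  define f where "f = (\<lambda>u. if u \<in> F then w u / of_real (fibre_weight u) else 0)"
  let ?s = "\<Sum>u\<in>F. (cmod (w u))\<^sup>2 / fibre_weight u"
  have le_1: "s \<le> 1" if "s\<^sup>2 \<le> s" "0 \<le> s" for s :: real
    using that by (cases "s = 0") (auto simp: power2_eq_square)
  have f: "f \<in> ell2 V"
    using F by (intro ell2_finite_support[of F]) (auto simp: f_def)
  have "coshift f v = (\<Sum>\<^sub>\<infinity>u\<in>F. of_real ((cmod (w u))\<^sup>2 / fibre_weight u))"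
    unfolding coshift_eq[OF v] complex_norm_square of_real_divide using F
    by (intro infsum_cong_neutral) (auto simp: f_def)
  then have cov: "coshift f v = of_real ?s"
    using F by simp
  have "?s\<^sup>2 = (\<Sum>u\<in>{v}. (cmod (coshift f u))\<^sup>2)"
    by (simp add: cov del: of_real_sum of_real_divide)
  also have "\<dots> \<le> (ell2_norm V (coshift f))\<^sup>2"
    unfolding ell2_norm_power2
    using v by (intro finite_sum_le_infsum ell2_summable coshift_mem f) auto
  also have "\<dots> \<le> (ell2_norm V (shift f))\<^sup>2"
    using hyp f by (simp add: hyponormal_iff_norm_coshift_le)
  also have "\<dots> = (\<Sum>\<^sub>\<infinity>u\<in>V. fibre_weight u * (cmod (f u))\<^sup>2)"
    by (rule norm_shift_power2[OF f])
  also have "\<dots> = (\<Sum>\<^sub>\<infinity>u\<in>F. (cmod (w u))\<^sup>2 / fibre_weight u)"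
    using F fibre_weight_nonneg
    by (intro infsum_cong_neutral) (auto simp: f_def norm_divide power_divide power2_eq_square)
  also have "\<dots> = ?s"
    using F by simp
  finally have "?s\<^sup>2 \<le> ?s" .
  moreover have "0 \<le> ?s"
    by (intro sum_nonneg divide_nonneg_nonneg fibre_weight_nonneg) auto
  ultimately show ?thesis
    by (rule le_1)
qed

text \<open>The test vector is now the basis vector at \<open>u\<close>: its image under
  \<open>coshift\<close> takes the value \<open>cnj (w u)\<close> at \<open>q u\<close>, so
  \<open>fibre_weight u\<close> is at least the square of \<open>cmod (w u)\<close>.\<close>

lemma hyponormal_imp_fibre_weight_pos:
  assumes hyp: "ell2_hyponormal V shift" and u: "u \<in> V" and w: "w u \<noteq> 0"
  shows "0 < fibre_weight u"
proof -
  note e = ell2_basis_mem[OF u]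
  have qu: "q u \<in> V"
    using q u by auto
  have "coshift (ell2_basis u) (q u) = (\<Sum>\<^sub>\<infinity>x\<in>{u}. cnj (w x))"
    unfolding coshift_eq[OF qu] using u
    by (intro infsum_cong_neutral) (auto simp: ell2_basis_def)
  then have "(cmod (w u))\<^sup>2 = (\<Sum>v\<in>{q u}. (cmod (coshift (ell2_basis u) v))\<^sup>2)"
    by simp
  also have "\<dots> \<le> (ell2_norm V (coshift (ell2_basis u)))\<^sup>2"
    unfolding ell2_norm_power2
    using qu by (intro finite_sum_le_infsum ell2_summable coshift_mem e) auto
  also have "\<dots> \<le> fibre_weight u"
    using hyp e by (simp add: hyponormal_iff_norm_coshift_le flip: norm_shift_basis[OF u])
  finally have "(cmod (w u))\<^sup>2 \<le> fibre_weight u" .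
  moreover have "0 < (cmod (w u))\<^sup>2"
    using w by simp
  ultimately show ?thesis
    by linarith
qed

lemma hyponormalI:
  assumes pos: "\<And>u. u \<in> V \<Longrightarrow> w u \<noteq> 0 \<Longrightarrow> 0 < fibre_weight u"
    and le: "\<And>v F. v \<in> V \<Longrightarrow> finite F \<Longrightarrow> F \<subseteq> fibre v
               \<Longrightarrow> (\<Sum>u\<in>F. (cmod (w u))\<^sup>2 / fibre_weight u) \<le> 1"
  shows "ell2_hyponormal V shift"
  unfolding hyponormal_iff_norm_coshift_le
proof
  fix f assume f: "f \<in> ell2 V"
  let ?g = "\<lambda>u. fibre_weight u * (cmod (f u))\<^sup>2"
  have g: "?g summable_on V"
    by (rule norm_shift_summable[OF f])
  have "(cmod (coshift f v))\<^sup>2 \<le> (\<Sum>\<^sub>\<infinity>u\<in>fibre v. ?g u)" if v: "v \<in> V" for v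
  proof -
    \<comment> \<open>Splitting \<open>cnj (w u) * f u\<close> into these factors makes
      Cauchy-Schwarz produce the sum bounded by 1 and the fibre part of the squared norm of
      \<open>shift f\<close>. If \<open>fibre_weight u = 0\<close>, then \<open>pos\<close> forces
      \<open>w u = 0\<close> and both sides vanish.\<close>
    let ?a = "\<lambda>u. cnj (w u) / of_real (sqrt (fibre_weight u))"
    let ?b = "\<lambda>u. of_real (sqrt (fibre_weight u)) * f u"
    have a: "(cmod (?a u))\<^sup>2 = (cmod (w u))\<^sup>2 / fibre_weight u" for u
      by (simp add: norm_divide power_divide fibre_weight_nonneg)
    have b: "(cmod (?b u))\<^sup>2 = ?g u" for u
      by (simp add: norm_mult power_mult_distrib fibre_weight_nonneg)
    have sa: "(\<lambda>u. (cmod (w u))\<^sup>2 / fibre_weight u) summable_on fibre v"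
      using le[OF v]
      by (intro nonneg_bdd_above_summable_on) (auto simp: fibre_weight_nonneg intro!: bdd_aboveI2)
    have la: "(\<Sum>\<^sub>\<infinity>u\<in>fibre v. (cmod (w u))\<^sup>2 / fibre_weight u) \<le> 1"
      by (rule infsum_le_finite_sums[OF sa]) (rule le[OF v])
    have sb: "?g summable_on fibre v"
      by (rule summable_on_subset_banach[OF g]) auto
    have "coshift f v = (\<Sum>\<^sub>\<infinity>u\<in>fibre v. ?a u * ?b u)"
      unfolding coshift_eq[OF v]
    proof (rule infsum_cong)
      fix u assume "u \<in> fibre v"
      then show "cnj (w u) * f u = ?a u * ?b u"
        using pos[of u] by (cases "w u = 0") auto
    qed
    then have "(cmod (coshift f v))\<^sup>2
        \<le> (\<Sum>\<^sub>\<infinity>u\<in>fibre v. (cmod (w u))\<^sup>2 / fibre_weight u) * (\<Sum>\<^sub>\<infinity>u\<in>fibre v. ?g u)"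
      using infsum_Cauchy_Schwarz(2)[of ?a "fibre v" ?b] sa sb unfolding a b by metis
    also have "\<dots> \<le> 1 * (\<Sum>\<^sub>\<infinity>u\<in>fibre v. ?g u)"
      by (intro mult_right_mono la infsum_nonneg) (simp add: fibre_weight_nonneg)
    finally show ?thesis by simp
  qed
  then have "(\<Sum>\<^sub>\<infinity>v\<in>V. (cmod (coshift f v))\<^sup>2) \<le> (\<Sum>\<^sub>\<infinity>v\<in>V. \<Sum>\<^sub>\<infinity>u\<in>fibre v. ?g u)"
    by (intro infsum_mono ell2_summable coshift_mem f infsum_fibres q g)
  then show "(ell2_norm V (coshift f))\<^sup>2 \<le> (ell2_norm V (shift f))\<^sup>2"
    by (simp add: ell2_norm_power2[of V "coshift f"] norm_shift_power2[OF f] infsum_fibres(2)[OF q g])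
qed

lemma hyponormal_iff:
  "ell2_hyponormal V shift \<longleftrightarrow>
     (\<forall>v\<in>V. (\<Sum>\<^sub>\<infinity>u\<in>fibre v. ennreal ((cmod (w u))\<^sup>2) / ennreal (fibre_weight u)) \<le> 1)"
  (is "_ \<longleftrightarrow> (\<forall>v\<in>V. ?h v \<le> 1)")
proof -
  \<comment> \<open>Real and \<open>ennreal\<close> division disagree only for a nonzero numerator
    over zero, where they give 0 and \<open>top\<close>; the premise excludes this case.\<close>
  have quotient: "ennreal ((cmod (w u))\<^sup>2) / ennreal (fibre_weight u)
                    = ennreal ((cmod (w u))\<^sup>2 / fibre_weight u)"
    if "w u \<noteq> 0 \<Longrightarrow> 0 < fibre_weight u" for u
    using that by (cases "w u = 0") (auto simp: divide_ennreal)
  have finite_sum: "(\<Sum>u\<in>F. ennreal ((cmod (w u))\<^sup>2) / ennreal (fibre_weight u)) \<le> 1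
      \<longleftrightarrow> (\<Sum>u\<in>F. (cmod (w u))\<^sup>2 / fibre_weight u) \<le> 1"
    if "\<And>u. u \<in> V \<Longrightarrow> w u \<noteq> 0 \<Longrightarrow> 0 < fibre_weight u" "F \<subseteq> fibre v" for v F
  proof -
    have "(\<Sum>u\<in>F. ennreal ((cmod (w u))\<^sup>2) / ennreal (fibre_weight u))
            = (\<Sum>u\<in>F. ennreal ((cmod (w u))\<^sup>2 / fibre_weight u))"
      using that by (intro sum.cong refl quotient) auto
    then show ?thesis
      by (simp add: sum_ennreal fibre_weight_nonneg)
  qed
  show ?thesis
  proof
    assume hyp: "ell2_hyponormal V shift"
    show "\<forall>v\<in>V. ?h v \<le> 1"
      unfolding infsum_ennreal_le_iff
    proof (intro ballI allI impI)
      fix v F assume "v \<in> V" and F: "finite F \<and> F \<subseteq> fibre v"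
      then have "(\<Sum>u\<in>F. (cmod (w u))\<^sup>2 / fibre_weight u) \<le> 1"
        using hyponormal_imp_finite_sum_le[OF hyp] by blast
      then show "(\<Sum>u\<in>F. ennreal ((cmod (w u))\<^sup>2) / ennreal (fibre_weight u)) \<le> 1"
        using F finite_sum[OF hyponormal_imp_fibre_weight_pos[OF hyp]] by blast
    qed
  next
    assume h: "\<forall>v\<in>V. ?h v \<le> 1"
    \<comment> \<open>A nonzero weight over a zero \<open>fibre_weight\<close> would give the
      quotient \<open>top\<close>, although \<open>{u}\<close> is a finite part of the fibre over
      \<open>q u\<close>, whose sum is at most 1.\<close>
    have pos: "0 < fibre_weight u" if u: "u \<in> V" "w u \<noteq> 0" for u
    proof (rule ccontr)
      assume "\<not> 0 < fibre_weight u"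
      then have "(\<Sum>u\<in>{u}. ennreal ((cmod (w u))\<^sup>2) / ennreal (fibre_weight u)) = top"
        using u fibre_weight_nonneg[of u] by (simp add: order_less_le)
      moreover have "(\<Sum>u\<in>{u}. ennreal ((cmod (w u))\<^sup>2) / ennreal (fibre_weight u)) \<le> 1"
      proof -
        have "?h (q u) \<le> 1"
          using h u q by auto
        then show ?thesis
          using u unfolding infsum_ennreal_le_iff by blast
      qed
      ultimately show False
        by (simp add: top_unique)
    qed
    show "ell2_hyponormal V shift"
    proof (rule hyponormalI[OF pos])
      fix v F assume "v \<in> V" and F: "finite F" "F \<subseteq> fibre v"
      then have "?h v \<le> 1"
        using h by blast
      then have "(\<Sum>u\<in>F. ennreal ((cmod (w u))\<^sup>2) / ennreal (fibre_weight u)) \<le> 1"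
        using F unfolding infsum_ennreal_le_iff by blast
      then show "(\<Sum>u\<in>F. (cmod (w u))\<^sup>2 / fibre_weight u) \<le> 1"
        using finite_sum[OF pos F(2)] by blast
    qed
  qed
qed

end

section \<open>Powers of a weighted shift on a forest\<close>

lemma ell2_bounded_operator_compose:
  assumes S: "ell2_bounded_operator V S" and T: "ell2_bounded_operator V T"
  shows "ell2_bounded_operator V (S \<circ> T)"
proof -
  obtain C where C: "\<And>f. f \<in> ell2 V \<Longrightarrow> ell2_norm V (S f) \<le> C * ell2_norm V f"
    using S unfolding ell2_bounded_operator_def by blast
  obtain D where D: "\<And>f. f \<in> ell2 V \<Longrightarrow> ell2_norm V (T f) \<le> D * ell2_norm V f"
    using T unfolding ell2_bounded_operator_def by blast
  \<comment> \<open>The bound \<open>C\<close> may be negative; \<open>max C 0\<close> keeps the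
    multiplication by it monotone.\<close>
  have "ell2_norm V ((S \<circ> T) f) \<le> (max C 0 * D) * ell2_norm V f" if f: "f \<in> ell2 V" for f
  proof -
    have "ell2_norm V (S (T f)) \<le> C * ell2_norm V (T f)"
      using T f by (intro C) (auto simp: ell2_bounded_operator_def)
    also have "\<dots> \<le> max C 0 * ell2_norm V (T f)"
      by (intro mult_right_mono ell2_norm_nonneg) auto
    also have "\<dots> \<le> max C 0 * (D * ell2_norm V f)"
      by (intro mult_left_mono D f) auto
    finally show ?thesis
      by (simp add: mult.assoc)
  qed
  then show ?thesis
    using S T by (auto simp: ell2_bounded_operator_def Pi_iff)
qed

lemma ell2_bounded_operator_funpow:
  assumes "ell2_bounded_operator V T" "k \<ge> 1"
  shows "ell2_bounded_operator V (T ^^ k)"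
  using assms(2)
proof (induction rule: dec_induct)
  case (step n)
  then show ?case
    unfolding funpow.simps by (intro ell2_bounded_operator_compose assms(1))
qed (simp add: assms(1))

lemma funpow_mem:
  assumes "p \<in> V \<rightarrow> V" "v \<in> V"
  shows "(p ^^ n) v \<in> V"
  using assms by (induction n) auto

text \<open>This is an equality on all functions, including those that do not vanish off
  \<open>V\<close>. Hence the induction starts at 1: the zeroth power is the identity, which does
  not cut off outside \<open>V\<close>.\<close>

lemma weighted_shift_funpow:
  assumes p: "p \<in> V \<rightarrow> V" and k: "k \<ge> 1"
  shows "weighted_shift V p lam ^^ k = weighted_shift V (p ^^ k) (iterated_weight p lam k)"
  using k
proof (induction rule: dec_induct)
  case (step n)
  then show ?case
    using p by (auto simp: fun_eq_iff weighted_shift_def funpow_swap1)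
qed (auto simp: fun_eq_iff weighted_shift_def)

lemma funpow_stable_at_fixpoint:
  assumes "p ((p ^^ m) v) = (p ^^ m) v" "m \<le> n"
  shows "(p ^^ n) v = (p ^^ m) v"
  using assms(2) by (induction rule: dec_induct) (simp_all add: assms(1))

text \<open>The iterated weight is the product of \<open>lam\<close> over \<open>v\<close>,
  \<open>p v\<close>, ..., \<open>(p ^^ n) v\<close>. It vanishes iff one of these is a root, and
  iteration stays at a root once it is reached, so only the last one needs testing.\<close>

lemma iterated_weight_eq_0_iff:
  assumes p: "p \<in> V \<rightarrow> V" and proper: "proper_weights V p lam" and v: "v \<in> V"
  shows "iterated_weight p lam (Suc n) v = 0 \<longleftrightarrow> (p ^^ n) v \<in> forest_roots V p"
  using v
proof (induction n arbitrary: v)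
  case (Suc n)
  have "(p ^^ Suc n) v \<in> forest_roots V p" if "v \<in> forest_roots V p"
    using that Suc.prems funpow_stable_at_fixpoint[of p 0 v "Suc n"] by (simp add: forest_roots_def)
  moreover have "lam v = 0 \<longleftrightarrow> v \<in> forest_roots V p"
    using proper Suc.prems by (auto simp: proper_weights_def)
  moreover have "iterated_weight p lam (Suc n) (p v) = 0 \<longleftrightarrow> (p ^^ Suc n) v \<in> forest_roots V p"
    using Suc.IH[of "p v"] Suc.prems p by (auto simp: funpow_swap1)
  ultimately show ?case
    unfolding iterated_weight.simps(2)[of p lam "Suc n"] mult_eq_0_iff by blast
qed (use proper in \<open>auto simp: proper_weights_def\<close>)

theorem theorem4p1:
  fixes V :: "'v set" and p :: "'v \<Rightarrow> 'v" and lam :: "'v \<Rightarrow> complex" and k :: nat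
  assumes "directed_forest V p"
    and "weight_system V p lam"
    and "proper_weights V p lam"
    and "ell2_bounded_operator V (weighted_shift V p lam)"
    and "k \<ge> 1"
  shows "ell2_hyponormal V (weighted_shift V p lam ^^ k) \<longleftrightarrow>
           leafless V (power_parent V p k) \<and> (\<forall>v\<in>V. h_fun V p lam k v \<le> 1)"
proof -
  have p: "p \<in> V \<rightarrow> V"
    using assms(1) by (simp add: directed_forest_def)
  let ?w = "iterated_weight p lam k"
  note shift = weighted_shift_funpow[OF p assms(5), of lam]
  interpret bounded_weighted_shift V "p ^^ k" ?w
    using ell2_bounded_operator_funpow[OF assms(4,5)] funpow_mem[OF p]
    by unfold_locales (auto simp: shift)
  obtain n where n: "k = Suc n"
    using assms(5) by (cases k) auto
  have w0: "?w u = 0 \<longleftrightarrow> (p ^^ n) u \<in> forest_roots V p" if "u \<in> V" for u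
    unfolding n by (rule iterated_weight_eq_0_iff[OF p assms(3) that])
  \<comment> \<open>With \<open>k = Suc n\<close>, the condition
    \<open>v \<noteq> (p ^^ (k - 1)) u\<close> says that \<open>(p ^^ n) u\<close> is not a root,
    that is, that the weight at \<open>u\<close> is nonzero.\<close>
  have chi: "forest_chi V p k v = {u \<in> fibre v. ?w u \<noteq> 0}" for v
    using w0 funpow_mem[OF p] by (auto simp: forest_chi_def forest_roots_def n)
  \<comment> \<open>Passing from the children to the whole fibre adds only terms with numerator 0,
    and these are 0 in \<open>ennreal\<close> even over a zero denominator.\<close>
  have "h_fun V p lam k v
      = (\<Sum>\<^sub>\<infinity>u\<in>fibre v. ennreal ((cmod (?w u))\<^sup>2) / ennreal (fibre_weight u))" for v
    unfolding h_fun_def chi shift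
    by (rule infsum_cong_neutral) (auto simp: norm_shift_basis)
  then have hyp_iff: "ell2_hyponormal V (weighted_shift V p lam ^^ k)
      \<longleftrightarrow> (\<forall>v\<in>V. h_fun V p lam k v \<le> 1)"
    unfolding shift using hyponormal_iff by simp
  \<comment> \<open>A vertex of weight 0 is its own parent in the power. Any other has positive
    \<open>fibre_weight\<close>, so its fibre contains some \<open>u\<close> with nonzero weight,
    and \<open>power_parent\<close> sends this \<open>u\<close> to it.\<close>
  have "leafless V (power_parent V p k)" if hyp: "ell2_hyponormal V (weighted_shift V p lam ^^ k)"
    unfolding leafless_def
  proof (intro equalityI subsetI)
    fix v assume v: "v \<in> V"
    show "v \<in> power_parent V p k ` V"
    proof (cases "?w v = 0")
      case True
      then have "power_parent V p k v = v"
        using w0[OF v] by (simp add: power_parent_def n)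
      then show ?thesis
        using v by (metis imageI)
    next
      case False
      then have "fibre_weight v \<noteq> 0"
        using hyponormal_imp_fibre_weight_pos[of v] hyp v by (simp add: shift)
      then have "\<exists>u\<in>fibre v. ?w u \<noteq> 0"
        unfolding fibre_weight_def by (rule contrapos_np) (auto intro: infsum_0)
      then obtain u where u: "u \<in> fibre v" "?w u \<noteq> 0"
        by blast
      then have "power_parent V p k u = v"
        using w0[of u] by (auto simp: power_parent_def n)
      then show ?thesis
        using u by auto
    qed
  qed (use p funpow_mem[OF p] in \<open>auto simp: power_parent_def\<close>)
  then show ?thesis
    using hyp_iff by blast
qed

end
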